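(* Let $R$ be a ring. If $M_1$ and $M_2$ are Rad-supplementing left $R$-modules, then so is $M_1\oplus M_2$.
   Context: Rings are associative with identity and modules are unitary left modules. For a module $M$, $\operatorname{Rad} M$ denotes the radical of $M$ (the intersection of all maximal submodules of $M$, equal to $M$ if there are none). For submodules $U,V$ of a module $N$, $V$ is a Rad-supplement of $U$ in $N$ if $U+V=N$ and $U\cap V\subseteq \operatorname{Rad} V$. A module $M$ is Rad-supplementing if $M$ has a Rad-supplement in every module $N$ that contains $M$ as a submodule. *)

theory Defs
  imports "HOL-Algebra.Module" "HOL-Algebra.AbelCoset"
begin

text \<open>
  The library locale \<open>module\<close> presupposes a commutative ring; the following is the same
  locale over an arbitrary ring. As there, the multiplicative components that the record type
  \<open>module\<close> inherits from \<open>ring\<close> carry no meaning. The library's notion of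
  \<open>submodule\<close> does not depend on commutativity and is used as it stands.
\<close>

locale left_module = R?: ring R + M?: abelian_group M for R (structure) and M (structure) +
  assumes smult_closed [simp, intro]:
      "\<lbrakk>a \<in> carrier R; x \<in> carrier M\<rbrakk> \<Longrightarrow> a \<odot>\<^bsub>M\<^esub> x \<in> carrier M"
    and smult_l_distr:
      "\<lbrakk>a \<in> carrier R; b \<in> carrier R; x \<in> carrier M\<rbrakk> \<Longrightarrow>
      (a \<oplus> b) \<odot>\<^bsub>M\<^esub> x = a \<odot>\<^bsub>M\<^esub> x \<oplus>\<^bsub>M\<^esub> b \<odot>\<^bsub>M\<^esub> x"
    and smult_r_distr:
      "\<lbrakk>a \<in> carrier R; x \<in> carrier M; y \<in> carrier M\<rbrakk> \<Longrightarrow>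
      a \<odot>\<^bsub>M\<^esub> (x \<oplus>\<^bsub>M\<^esub> y) = a \<odot>\<^bsub>M\<^esub> x \<oplus>\<^bsub>M\<^esub> a \<odot>\<^bsub>M\<^esub> y"
    and smult_assoc1:
      "\<lbrakk>a \<in> carrier R; b \<in> carrier R; x \<in> carrier M\<rbrakk> \<Longrightarrow>
      (a \<otimes> b) \<odot>\<^bsub>M\<^esub> x = a \<odot>\<^bsub>M\<^esub> (b \<odot>\<^bsub>M\<^esub> x)"
    and smult_one [simp]:
      "x \<in> carrier M \<Longrightarrow> \<one> \<odot>\<^bsub>M\<^esub> x = x"

definition left_module_hom ::
    "('r, 'q) ring_scheme \<Rightarrow> ('r, 'a, 'm) module_scheme \<Rightarrow> ('r, 'b, 'n) module_scheme \<Rightarrow> ('a \<Rightarrow> 'b) set"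
  where "left_module_hom R M N =
    {f \<in> carrier M \<rightarrow> carrier N.
      (\<forall>x \<in> carrier M. \<forall>y \<in> carrier M. f (x \<oplus>\<^bsub>M\<^esub> y) = f x \<oplus>\<^bsub>N\<^esub> f y) \<and>
      (\<forall>a \<in> carrier R. \<forall>x \<in> carrier M. f (a \<odot>\<^bsub>M\<^esub> x) = a \<odot>\<^bsub>N\<^esub> f x)}"

definition direct_sum ::
    "('r, 'a, 'm) module_scheme \<Rightarrow> ('r, 'b, 'n) module_scheme \<Rightarrow> ('r, 'a \<times> 'b) module"
  where "direct_sum M N =
    \<lparr>carrier = carrier M \<times> carrier N,
     mult = (\<lambda>(x, y) (x', y'). (x \<otimes>\<^bsub>M\<^esub> x', y \<otimes>\<^bsub>N\<^esub> y')),
     one = (\<one>\<^bsub>M\<^esub>, \<one>\<^bsub>N\<^esub>),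
     zero = (\<zero>\<^bsub>M\<^esub>, \<zero>\<^bsub>N\<^esub>),
     add = (\<lambda>(x, y) (x', y'). (x \<oplus>\<^bsub>M\<^esub> x', y \<oplus>\<^bsub>N\<^esub> y')),
     smult = (\<lambda>a (x, y). (a \<odot>\<^bsub>M\<^esub> x, a \<odot>\<^bsub>N\<^esub> y))\<rparr>"

lemma left_module_direct_sum:
  assumes "left_module R M" and "left_module R N"
  shows "left_module R (direct_sum M N)"
proof -
  interpret M: left_module R M by fact
  interpret N: left_module R N by fact
  have "abelian_group (direct_sum M N)"
  proof (rule abelian_groupI)
    fix x assume "x \<in> carrier (direct_sum M N)"
    then show "\<exists>y \<in> carrier (direct_sum M N). y \<oplus>\<^bsub>direct_sum M N\<^esub> x = \<zero>\<^bsub>direct_sum M N\<^esub>"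
      by (intro bexI[of _ "(\<ominus>\<^bsub>M\<^esub> fst x, \<ominus>\<^bsub>N\<^esub> snd x)"])
        (auto simp: direct_sum_def M.l_neg N.l_neg)
  qed (auto simp: direct_sum_def M.a_ac N.a_ac)
  then show ?thesis
    unfolding left_module_def left_module_axioms_def
    using M.R.ring_axioms
    by (auto simp: direct_sum_def M.smult_l_distr N.smult_l_distr M.smult_r_distr
        N.smult_r_distr M.smult_assoc1 N.smult_assoc1)
qed

definition maximal_submodule ::
    "('r, 'q) ring_scheme \<Rightarrow> ('r, 'a, 'm) module_scheme \<Rightarrow> 'a set \<Rightarrow> bool"
  where "maximal_submodule R M K \<longleftrightarrow>
    submodule K R M \<and> K \<noteq> carrier M \<and>
    (\<forall>L. submodule L R M \<longrightarrow> K \<subseteq> L \<longrightarrow> L = K \<or> L = carrier M)"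

text \<open>
  Intersecting with the carrier gives the usual convention \<open>Rad M = M\<close> when \<open>M\<close> has no
  maximal submodules.
\<close>

definition Rad :: "('r, 'q) ring_scheme \<Rightarrow> ('r, 'a, 'm) module_scheme \<Rightarrow> 'a set"
  where "Rad R M = carrier M \<inter> \<Inter>{K. maximal_submodule R M K}"

definition rad_supplement ::
    "('r, 'q) ring_scheme \<Rightarrow> ('r, 'a, 'm) module_scheme \<Rightarrow> 'a set \<Rightarrow> 'a set \<Rightarrow> bool"
  where "rad_supplement R N U V \<longleftrightarrow>
    submodule U R N \<and> submodule V R N \<and>
    U <+>\<^bsub>N\<^esub> V = carrier N \<and> U \<inter> V \<subseteq> Rad R (N\<lparr>carrier := V\<rparr>)"

text \<open>
  A module containing \<open>M\<close> as a submodule is rendered as a module \<open>N\<close> together with an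
  injective homomorphism from \<open>M\<close> into \<open>N\<close>, so that \<open>N\<close> is not confined to the
  type of the elements of \<open>M\<close>. A formula of HOL cannot quantify over types, so the type
  \<open>'c\<close> over which the modules \<open>N\<close> range is a parameter of the notion; being
  Rad-supplementing outright means that this holds for every type \<open>'c\<close>.
\<close>

definition rad_supplementing ::
    "'c itself \<Rightarrow> ('r, 'q) ring_scheme \<Rightarrow> ('r, 'a, 'm) module_scheme \<Rightarrow> bool"
  where "rad_supplementing (_ :: 'c itself) R M \<longleftrightarrow>
    left_module R M \<and>
    (\<forall>(N :: ('r, 'c) module) f.
      left_module R N \<longrightarrow> f \<in> left_module_hom R M N \<longrightarrow> inj_on f (carrier M) \<longrightarrow>
      (\<exists>V. rad_supplement R N (f ` carrier M) V))"

end

theory Submission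
  imports Defs
begin

text \<open>
  Let \<open>M\<^sub>1 \<oplus> M\<^sub>2\<close> be a submodule of \<open>N\<close>. As \<open>M\<^sub>2\<close> embeds into \<open>N / M\<^sub>1\<close>, it has a
  Rad-supplement \<open>V / M\<^sub>1\<close> there, and \<open>M\<^sub>1\<close> has a Rad-supplement \<open>W\<close> in \<open>V\<close>. Then \<open>W\<close> is a
  Rad-supplement of \<open>M\<^sub>1 \<oplus> M\<^sub>2\<close> in \<open>N\<close>: the map \<open>W \<rightarrow> V / M\<^sub>1\<close> is surjective and its kernel
  \<open>M\<^sub>1 \<inter> W\<close> lies in \<open>Rad W\<close>, so that \<open>Rad W\<close> is the full preimage of \<open>Rad (V / M\<^sub>1)\<close>, and
  the latter contains the image of \<open>(M\<^sub>1 \<oplus> M\<^sub>2) \<inter> W\<close>.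
\<close>

section \<open>Arithmetic and submodules of a module over an arbitrary ring\<close>

context left_module
begin

lemma smult_l_null:
  assumes "x \<in> carrier M"
  shows "\<zero> \<odot>\<^bsub>M\<^esub> x = \<zero>\<^bsub>M\<^esub>"
proof -
  have "\<zero> \<odot>\<^bsub>M\<^esub> x \<oplus>\<^bsub>M\<^esub> \<zero> \<odot>\<^bsub>M\<^esub> x = \<zero> \<odot>\<^bsub>M\<^esub> x"
    using smult_l_distr[of \<zero> \<zero> x] assms by simp
  then show ?thesis
    using assms M.add.r_cancel_one by auto
qed

lemma smult_r_null:
  assumes "a \<in> carrier R"
  shows "a \<odot>\<^bsub>M\<^esub> \<zero>\<^bsub>M\<^esub> = \<zero>\<^bsub>M\<^esub>"
proof -
  have "a \<odot>\<^bsub>M\<^esub> \<zero>\<^bsub>M\<^esub> \<oplus>\<^bsub>M\<^esub> a \<odot>\<^bsub>M\<^esub> \<zero>\<^bsub>M\<^esub> = a \<odot>\<^bsub>M\<^esub> \<zero>\<^bsub>M\<^esub>"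
    using smult_r_distr[of a "\<zero>\<^bsub>M\<^esub>" "\<zero>\<^bsub>M\<^esub>"] assms by simp
  then show ?thesis
    using assms M.add.r_cancel_one by auto
qed

lemma smult_minus_one:
  assumes "x \<in> carrier M"
  shows "(\<ominus> \<one>) \<odot>\<^bsub>M\<^esub> x = \<ominus>\<^bsub>M\<^esub> x"
proof -
  have "(\<ominus> \<one>) \<odot>\<^bsub>M\<^esub> x \<oplus>\<^bsub>M\<^esub> x = \<zero>\<^bsub>M\<^esub>"
    using smult_l_distr[of "\<ominus> \<one>" \<one> x] assms by (simp add: R.l_neg smult_l_null)
  then show ?thesis
    using assms by (metis M.minus_equality R.a_inv_closed R.one_closed smult_closed)
qed

lemma minus_eq_zero_iff:
  assumes "x \<in> carrier M" "y \<in> carrier M"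
  shows "x \<ominus>\<^bsub>M\<^esub> y = \<zero>\<^bsub>M\<^esub> \<longleftrightarrow> x = y"
  using assms M.minus_equality[of x "\<ominus>\<^bsub>M\<^esub> y"] by (auto simp: a_minus_def M.r_neg)

text \<open>Closure under negatives comes from scalar multiplication by minus one, so the four
  conditions recover the subgroup axioms inside \<open>submodule\<close>.\<close>

lemma submodule_iff:
  "submodule H R M \<longleftrightarrow> H \<subseteq> carrier M \<and> \<zero>\<^bsub>M\<^esub> \<in> H \<and>
    (\<forall>x\<in>H. \<forall>y\<in>H. x \<oplus>\<^bsub>M\<^esub> y \<in> H) \<and> (\<forall>a\<in>carrier R. \<forall>x\<in>H. a \<odot>\<^bsub>M\<^esub> x \<in> H)"
  (is "_ \<longleftrightarrow> ?P")
proof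
  assume "submodule H R M"
  then interpret submodule H R M .
  show ?P
    using subset one_closed m_closed smult_closed by simp
next
  assume H: ?P
  then have "\<ominus>\<^bsub>M\<^esub> x \<in> H" if "x \<in> H" for x
    using that smult_minus_one[of x] by (metis R.a_inv_closed R.one_closed subsetD)
  with H show "submodule H R M"
    by (intro submodule.intro subgroup.intro submodule_axioms.intro) (auto simp: a_inv_def)
qed

lemma submodule_minus:
  assumes "submodule H R M" "x \<in> H" "y \<in> H"
  shows "x \<ominus>\<^bsub>M\<^esub> y \<in> H"
  using assms smult_minus_one[of y] unfolding submodule_iff a_minus_def
  by (metis R.a_inv_closed R.one_closed subsetD)

lemma left_module_submodule:
  assumes "submodule H R M"
  shows "left_module R (M\<lparr>carrier := H\<rparr>)"
proof -
  have H: "H \<subseteq> carrier M" "\<zero>\<^bsub>M\<^esub> \<in> H" "\<And>x y. x \<in> H \<Longrightarrow> y \<in> H \<Longrightarrow> x \<oplus>\<^bsub>M\<^esub> y \<in> H"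
    "\<And>a x. a \<in> carrier R \<Longrightarrow> x \<in> H \<Longrightarrow> a \<odot>\<^bsub>M\<^esub> x \<in> H"
    using assms by (auto simp: submodule_iff)
  have "abelian_group (M\<lparr>carrier := H\<rparr>)"
  proof (rule abelian_groupI)
    fix x assume "x \<in> carrier (M\<lparr>carrier := H\<rparr>)"
    then have x: "x \<in> H" by simp
    then have "\<ominus>\<^bsub>M\<^esub> x \<in> H"
      using H(1) H(4)[of "\<ominus> \<one>" x] smult_minus_one[of x] by auto
    then show "\<exists>y \<in> carrier (M\<lparr>carrier := H\<rparr>). y \<oplus>\<^bsub>M\<lparr>carrier := H\<rparr>\<^esub> x = \<zero>\<^bsub>M\<lparr>carrier := H\<rparr>\<^esub>"
      using x H(1) by (intro bexI[of _ "\<ominus>\<^bsub>M\<^esub> x"]) (auto simp: M.l_neg)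
  qed (use H in \<open>auto simp: M.a_ac subset_iff\<close>)
  then show ?thesis
    unfolding left_module_def left_module_axioms_def
    using R.ring_axioms H
    by (auto simp: smult_l_distr smult_r_distr smult_assoc1 subset_iff)
qed

text \<open>The restricted module keeps the operations and the zero of \<open>M\<close>, so both
  sides impose the same closure conditions on \<open>H\<close>. This moves a supplement found inside
  a submodule out to the ambient module.\<close>

lemma submodule_carrier_update_iff:
  assumes "submodule V R M"
  shows "submodule H R (M\<lparr>carrier := V\<rparr>) \<longleftrightarrow> submodule H R M \<and> H \<subseteq> V"
  using assms
  unfolding left_module.submodule_iff[OF left_module_submodule[OF assms]] submodule_iff
  by auto

section \<open>Quotient modules as epimorphic images\<close>

text \<open>Each module axiom for \<open>Q\<close> is the image under \<open>p\<close> of the same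
  axiom in \<open>M\<close>, as every element of \<open>Q\<close> has a preimage. The value of
  \<open>p\<close> at zero is assumed because additivity does not yield it while \<open>Q\<close> is
  not yet known to be a group.\<close>

lemma left_module_epi_image:
  assumes hom: "p \<in> left_module_hom R M Q" and surj: "p ` carrier M = carrier Q"
    and zero: "p \<zero>\<^bsub>M\<^esub> = \<zero>\<^bsub>Q\<^esub>"
  shows "left_module R Q"
proof -
  have p_add: "p x \<oplus>\<^bsub>Q\<^esub> p y = p (x \<oplus>\<^bsub>M\<^esub> y)" if "x \<in> carrier M" "y \<in> carrier M" for x y
    using hom that by (simp add: left_module_hom_def)
  have p_smult: "a \<odot>\<^bsub>Q\<^esub> p x = p (a \<odot>\<^bsub>M\<^esub> x)" if "a \<in> carrier R" "x \<in> carrier M" for a x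
    using hom that by (simp add: left_module_hom_def)
  have "abelian_group Q"
  proof (rule abelian_groupI)
    fix x assume "x \<in> carrier Q"
    then obtain x' where "x' \<in> carrier M" "x = p x'"
      using surj by blast
    then show "\<exists>y \<in> carrier Q. y \<oplus>\<^bsub>Q\<^esub> x = \<zero>\<^bsub>Q\<^esub>"
      by (intro bexI[of _ "p (\<ominus>\<^bsub>M\<^esub> x')"]) (auto simp: p_add M.l_neg zero simp flip: surj)
  qed (auto simp: p_add M.a_ac simp flip: surj zero)
  then show ?thesis
    unfolding left_module_def left_module_axioms_def
    using R.ring_axioms
    by (auto simp: p_add p_smult smult_l_distr smult_r_distr smult_assoc1 simp flip: surj)
qed

text \<open>
  The modules over which \<open>rad_supplementing\<close> quantifies have a fixed element type, so the
  quotient is built on coset representatives instead of cosets.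
\<close>

lemma quotient_same_type:
  assumes "submodule A R M"
  obtains Q p
  where "left_module R (Q :: ('a, 'c, 'd) module_scheme)" "p \<in> left_module_hom R M Q"
    "p ` carrier M = carrier Q" "\<And>x. x \<in> carrier M \<Longrightarrow> p x = \<zero>\<^bsub>Q\<^esub> \<longleftrightarrow> x \<in> A"
proof -
  have A: "A \<subseteq> carrier M" "\<zero>\<^bsub>M\<^esub> \<in> A" "\<And>x y. x \<in> A \<Longrightarrow> y \<in> A \<Longrightarrow> x \<oplus>\<^bsub>M\<^esub> y \<in> A"
    "\<And>a x. a \<in> carrier R \<Longrightarrow> x \<in> A \<Longrightarrow> a \<odot>\<^bsub>M\<^esub> x \<in> A"
    using assms by (auto simp: submodule_iff)
  \<comment> \<open>Congruence modulo \<open>A\<close>, confined to the carrier.\<close>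
  define E where "E = (\<lambda>x y. x \<in> carrier M \<and> y \<in> carrier M \<and> (\<exists>a\<in>A. x = y \<oplus>\<^bsub>M\<^esub> a))"
  have E_refl: "E x x" if "x \<in> carrier M" for x
    using that A(2) by (auto simp: E_def intro!: bexI[of _ "\<zero>\<^bsub>M\<^esub>"])
  have E_sym: "E y x" if "E x y" for x y
  proof -
    obtain a where a: "a \<in> A" "x = y \<oplus>\<^bsub>M\<^esub> a" and c: "x \<in> carrier M" "y \<in> carrier M"
      using \<open>E x y\<close> by (auto simp: E_def)
    have ac: "a \<in> carrier M"
      using a A(1) by auto
    \<comment> \<open>Writing the negative of \<open>a\<close> as a difference from zero lets
      \<open>submodule_minus\<close> place it in \<open>A\<close>.\<close>
    have "y = x \<oplus>\<^bsub>M\<^esub> (\<zero>\<^bsub>M\<^esub> \<ominus>\<^bsub>M\<^esub> a)"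
      using a(2) c ac by (simp add: a_minus_def M.a_assoc M.r_neg)
    then show ?thesis
      using c submodule_minus[OF assms A(2) a(1)] unfolding E_def by blast
  qed
  have E_trans: "E x z" if xy: "E x y" and yz: "E y z" for x y z
  proof -
    obtain a b where ab: "a \<in> A" "b \<in> A" "x = y \<oplus>\<^bsub>M\<^esub> a" "y = z \<oplus>\<^bsub>M\<^esub> b"
      and c: "x \<in> carrier M" "z \<in> carrier M"
      using xy yz by (auto simp: E_def)
    moreover have "x = z \<oplus>\<^bsub>M\<^esub> (b \<oplus>\<^bsub>M\<^esub> a)"
      using ab c A(1) by (simp add: M.a_assoc subset_iff)
    ultimately show ?thesis
      using A(3)[of b a] unfolding E_def by blast
  qed
  have E_add: "E (x \<oplus>\<^bsub>M\<^esub> y) (x' \<oplus>\<^bsub>M\<^esub> y')" if xx: "E x x'" and yy: "E y y'" for x y x' y'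
  proof -
    obtain a b where ab: "a \<in> A" "b \<in> A" "x = x' \<oplus>\<^bsub>M\<^esub> a" "y = y' \<oplus>\<^bsub>M\<^esub> b"
      and c: "x \<in> carrier M" "x' \<in> carrier M" "y \<in> carrier M" "y' \<in> carrier M"
      using xx yy by (auto simp: E_def)
    then have "x \<oplus>\<^bsub>M\<^esub> y = (x' \<oplus>\<^bsub>M\<^esub> y') \<oplus>\<^bsub>M\<^esub> (a \<oplus>\<^bsub>M\<^esub> b)"
      using A(1) by (simp add: M.a_ac subset_iff)
    then show ?thesis
      using A(3)[OF ab(1,2)] c unfolding E_def by (metis M.a_closed)
  qed
  have E_smult: "E (r \<odot>\<^bsub>M\<^esub> x) (r \<odot>\<^bsub>M\<^esub> y)" if r: "r \<in> carrier R" and xy: "E x y" for r x y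
  proof -
    obtain a where a: "a \<in> A" "x = y \<oplus>\<^bsub>M\<^esub> a" and c: "x \<in> carrier M" "y \<in> carrier M"
      using xy by (auto simp: E_def)
    then have "r \<odot>\<^bsub>M\<^esub> x = r \<odot>\<^bsub>M\<^esub> y \<oplus>\<^bsub>M\<^esub> r \<odot>\<^bsub>M\<^esub> a"
      using A(1) r by (simp add: smult_r_distr subset_iff)
    then show ?thesis
      using A(4)[OF r a(1)] c r unfolding E_def by (metis smult_closed)
  qed
  \<comment> \<open>\<open>p\<close> picks one representative from each coset: congruent elements
    have equal predicates \<open>E x\<close>, hence the same choice.\<close>
  define p where "p = (\<lambda>x. SOME y. E x y)"
  have E_p: "E x (p x)" if "x \<in> carrier M" for x
    unfolding p_def using E_refl[OF that] by (rule someI)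
  have p_eq: "p x = p y \<longleftrightarrow> E x y" if "x \<in> carrier M" "y \<in> carrier M" for x y
  proof
    assume "p x = p y"
    then show "E x y"
      using E_p that E_sym E_trans by metis
  next
    assume "E x y"
    then have "E x = E y"
      using E_sym E_trans by blast
    then show "p x = p y"
      by (simp add: p_def)
  qed
  have p_closed: "p x \<in> carrier M" if "x \<in> carrier M" for x
    using E_p[OF that] by (simp add: E_def)
  \<comment> \<open>The elements of \<open>Q\<close> are the chosen representatives, and each
    operation is that of \<open>M\<close> followed by a return to the representative. The zero is
    the representative of \<open>A\<close>, which may differ from the zero of
    \<open>M\<close>.\<close>
  define Q where "Q = M\<lparr>carrier := p ` carrier M, zero := p \<zero>\<^bsub>M\<^esub>,
    add := (\<lambda>x y. p (x \<oplus>\<^bsub>M\<^esub> y)), smult := (\<lambda>a x. p (a \<odot>\<^bsub>M\<^esub> x))\<rparr>"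
  \<comment> \<open>By \<open>p_eq\<close>, the homomorphism equations say that replacing arguments
    by their representatives keeps the result in the same coset; this is \<open>E_add\<close> and
    \<open>E_smult\<close> applied to \<open>E_p\<close>.\<close>
  have hom: "p \<in> left_module_hom R M Q"
    by (auto simp: left_module_hom_def Q_def p_eq p_closed E_p E_add E_smult)
  have surj: "p ` carrier M = carrier Q" and zero: "p \<zero>\<^bsub>M\<^esub> = \<zero>\<^bsub>Q\<^esub>"
    by (simp_all add: Q_def)
  have ker: "p x = \<zero>\<^bsub>Q\<^esub> \<longleftrightarrow> x \<in> A" if "x \<in> carrier M" for x
    using that A(1) by (auto simp: p_eq E_def subset_iff simp flip: zero intro!: bexI[of _ x])
  show ?thesis
    using that[OF left_module_epi_image[OF hom surj zero] hom surj ker] .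
qed

end

section \<open>Homomorphisms, images and preimages of submodules\<close>

lemma left_module_hom_zero:
  assumes "left_module R M" "left_module R N" "f \<in> left_module_hom R M N"
  shows "f \<zero>\<^bsub>M\<^esub> = \<zero>\<^bsub>N\<^esub>"
proof -
  interpret M: left_module R M by fact
  interpret N: left_module R N by fact
  \<comment> \<open>The definition of \<open>left_module_hom\<close> asks for additivity and
    compatibility with scalars, so zero is reached as a multiple by the zero scalar.\<close>
  have "f (\<zero>\<^bsub>R\<^esub> \<odot>\<^bsub>M\<^esub> \<zero>\<^bsub>M\<^esub>) = \<zero>\<^bsub>R\<^esub> \<odot>\<^bsub>N\<^esub> f \<zero>\<^bsub>M\<^esub>" "f \<zero>\<^bsub>M\<^esub> \<in> carrier N"
    using assms(3) by (auto simp: left_module_hom_def)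
  then show ?thesis
    by (simp add: M.smult_l_null N.smult_l_null)
qed

lemma left_module_hom_minus:
  assumes "left_module R M" "left_module R N" "f \<in> left_module_hom R M N"
    and "x \<in> carrier M" "y \<in> carrier M"
  shows "f (x \<ominus>\<^bsub>M\<^esub> y) = f x \<ominus>\<^bsub>N\<^esub> f y"
proof -
  interpret M: left_module R M by fact
  interpret N: left_module R N by fact
  have "f ((\<ominus>\<^bsub>R\<^esub> \<one>\<^bsub>R\<^esub>) \<odot>\<^bsub>M\<^esub> y) = (\<ominus>\<^bsub>R\<^esub> \<one>\<^bsub>R\<^esub>) \<odot>\<^bsub>N\<^esub> f y" "f y \<in> carrier N"
    using assms(3,5) by (auto simp: left_module_hom_def)
  then have "f (\<ominus>\<^bsub>M\<^esub> y) = \<ominus>\<^bsub>N\<^esub> f y"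
    using assms(5) by (simp add: M.smult_minus_one N.smult_minus_one)
  then show ?thesis
    using assms(3-5) by (simp add: left_module_hom_def a_minus_def)
qed

lemma submodule_hom_image:
  assumes "left_module R M" "left_module R N" "f \<in> left_module_hom R M N" "submodule K R M"
  shows "submodule (f ` K) R N"
proof -
  interpret M: left_module R M by fact
  interpret N: left_module R N by fact
  have K: "K \<subseteq> carrier M" "\<zero>\<^bsub>M\<^esub> \<in> K" "\<And>x y. x \<in> K \<Longrightarrow> y \<in> K \<Longrightarrow> x \<oplus>\<^bsub>M\<^esub> y \<in> K"
    "\<And>a x. a \<in> carrier R \<Longrightarrow> x \<in> K \<Longrightarrow> a \<odot>\<^bsub>M\<^esub> x \<in> K"
    using assms(4) by (auto simp: M.submodule_iff)
  have add: "f x \<oplus>\<^bsub>N\<^esub> f y = f (x \<oplus>\<^bsub>M\<^esub> y)" if "x \<in> K" "y \<in> K" for x y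
    using assms(3) K(1) that by (auto simp: left_module_hom_def subset_iff)
  have smult: "a \<odot>\<^bsub>N\<^esub> f x = f (a \<odot>\<^bsub>M\<^esub> x)" if "a \<in> carrier R" "x \<in> K" for a x
    using assms(3) K(1) that by (auto simp: left_module_hom_def subset_iff)
  have "\<zero>\<^bsub>N\<^esub> \<in> f ` K"
    using left_module_hom_zero[OF assms(1-3)] K(2) by (metis imageI)
  moreover have "f ` K \<subseteq> carrier N"
    using assms(3) K(1) by (auto simp: left_module_hom_def)
  ultimately show ?thesis
    using K(3,4) by (auto simp: N.submodule_iff add smult)
qed

lemma submodule_hom_vimage:
  assumes "left_module R M" "left_module R N" "f \<in> left_module_hom R M N" "submodule L R N"
  shows "submodule {x \<in> carrier M. f x \<in> L} R M"
proof -
  interpret M: left_module R M by fact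
  interpret N: left_module R N by fact
  show ?thesis
    using assms(3,4) left_module_hom_zero[OF assms(1-3)]
    by (auto simp: M.submodule_iff N.submodule_iff left_module_hom_def)
qed

section \<open>Radicals and Rad-supplements along a surjection\<close>

text \<open>A maximal submodule \<open>K\<close> of \<open>W\<close> contains
  \<open>Rad R W\<close>, hence the kernel of \<open>p\<close>. So \<open>K\<close> is the full
  preimage of its image, this image is maximal in \<open>Q\<close>, and membership of
  \<open>p x\<close> in it brings \<open>x\<close> back into \<open>K\<close>.\<close>

lemma Rad_hom_vimage:
  assumes "left_module R W" "left_module R Q" and hom: "p \<in> left_module_hom R W Q"
    and surj: "p ` carrier W = carrier Q"
    and ker: "\<And>w. w \<in> carrier W \<Longrightarrow> p w = \<zero>\<^bsub>Q\<^esub> \<Longrightarrow> w \<in> Rad R W"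
    and x: "x \<in> carrier W" "p x \<in> Rad R Q"
  shows "x \<in> Rad R W"
proof -
  interpret W: left_module R W by fact
  interpret Q: left_module R Q by fact
  have "x \<in> K" if K: "maximal_submodule R W K" for K
  proof -
    have K': "submodule K R W" "K \<noteq> carrier W"
      "\<And>L. submodule L R W \<Longrightarrow> K \<subseteq> L \<Longrightarrow> L = K \<or> L = carrier W"
      using K by (auto simp: maximal_submodule_def)
    have sub: "K \<subseteq> carrier W"
      using K'(1) by (simp add: W.submodule_iff)
    \<comment> \<open>Two elements with equal image differ by a kernel element, which lies in
      \<open>K\<close>.\<close>
    have mem: "w \<in> K" if w: "w \<in> carrier W" "p w \<in> p ` K" for w
    proof -
      obtain k where k: "k \<in> K" "p w = p k"
        using w(2) by blast
      have "k \<in> carrier W" "p k \<in> carrier Q"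
        using k sub surj by auto
      then have "p (w \<ominus>\<^bsub>W\<^esub> k) = \<zero>\<^bsub>Q\<^esub>"
        using left_module_hom_minus[OF assms(1-3) w(1)] k(2) by (simp add: Q.minus_eq_zero_iff)
      then have "w \<ominus>\<^bsub>W\<^esub> k \<in> K"
        using ker[of "w \<ominus>\<^bsub>W\<^esub> k"] w(1) \<open>k \<in> carrier W\<close> K by (auto simp: Rad_def)
      then have "(w \<ominus>\<^bsub>W\<^esub> k) \<oplus>\<^bsub>W\<^esub> k \<in> K"
        using K'(1) k(1) by (simp add: W.submodule_iff)
      then show ?thesis
        using w(1) \<open>k \<in> carrier W\<close> by (simp add: a_minus_def W.M.a_assoc W.M.l_neg)
    qed
    have "maximal_submodule R Q (p ` K)"
      unfolding maximal_submodule_def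
    proof (intro conjI allI impI)
      show "submodule (p ` K) R Q"
        using submodule_hom_image[OF assms(1-3) K'(1)] .
      \<comment> \<open>Were the image everything, \<open>mem\<close> would put all of
        \<open>W\<close> into \<open>K\<close>.\<close>
      show "p ` K \<noteq> carrier Q"
        using mem K'(2) sub surj by blast
      fix L assume L: "submodule L R Q" "p ` K \<subseteq> L"
      \<comment> \<open>The maximality of \<open>K\<close> is applied to the preimage of
        \<open>L\<close>; surjectivity then recovers \<open>L\<close> as the image of
        \<open>L'\<close>.\<close>
      define L' where "L' = {w \<in> carrier W. p w \<in> L}"
      have "submodule L' R W" "K \<subseteq> L'"
        using submodule_hom_vimage[OF assms(1-3) L(1)] L(2) sub by (auto simp: L'_def)
      then have "L' = K \<or> L' = carrier W"
        by (rule K'(3))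
      moreover have "p ` L' = p ` carrier W \<inter> L"
        by (auto simp: L'_def)
      then have "p ` L' = L"
        using L(1) by (auto simp: surj Q.submodule_iff)
      ultimately show "L = p ` K \<or> L = carrier Q"
        using surj by metis
    qed
    then have "p x \<in> p ` K"
      using x(2) by (auto simp: Rad_def)
    then show ?thesis
      using mem x(1) by blast
  qed
  then show ?thesis
    using x(1) by (auto simp: Rad_def)
qed

text \<open>\<open>Q\<close> plays the quotient of \<open>N\<close> by \<open>A\<close>, and
  \<open>U\<close> may be any submodule above \<open>A\<close>. A Rad-supplement is lifted along
  \<open>p\<close> at the price of supplementing \<open>A\<close> inside the preimage of
  \<open>V\<close>.\<close>

lemma rad_supplement_vimage:
  assumes N: "left_module R N" and Q: "left_module R Q" and hom: "p \<in> left_module_hom R N Q"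
    and surj: "p ` carrier N = carrier Q"
    and ker: "\<And>x. x \<in> carrier N \<Longrightarrow> p x = \<zero>\<^bsub>Q\<^esub> \<longleftrightarrow> x \<in> A"
    and U: "submodule U R N" "A \<subseteq> U"
    and V: "rad_supplement R Q (p ` U) V"
    and W: "rad_supplement R (N\<lparr>carrier := {x \<in> carrier N. p x \<in> V}\<rparr>) A W"
  shows "rad_supplement R N U W"
proof -
  interpret N: left_module R N by fact
  interpret Q: left_module R Q by fact
  \<comment> \<open>In the notation of the overview, \<open>P\<close> is the submodule between
    \<open>A\<close> and \<open>N\<close>, and \<open>V\<close> corresponds to its quotient by
    \<open>A\<close>.\<close>
  define P where "P = {x \<in> carrier N. p x \<in> V}"
  have V': "submodule V R Q" "p ` U <+>\<^bsub>Q\<^esub> V = carrier Q" "p ` U \<inter> V \<subseteq> Rad R (Q\<lparr>carrier := V\<rparr>)"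
    using V by (auto simp: rad_supplement_def)
  have P: "submodule P R N"
    unfolding P_def using submodule_hom_vimage[OF N Q hom V'(1)] .
  \<comment> \<open>The second carrier update overrides the first, and sums of sets look only at the
    addition, so facts about \<open>W\<close> inside \<open>P\<close> become facts about
    \<open>W\<close> inside \<open>N\<close>.\<close>
  have W': "submodule W R N" "W \<subseteq> P" "A \<subseteq> P" "A <+>\<^bsub>N\<^esub> W = P"
    "A \<inter> W \<subseteq> Rad R (N\<lparr>carrier := W\<rparr>)"
    using W N.submodule_carrier_update_iff[OF P]
    by (auto simp: rad_supplement_def set_add_def' simp flip: P_def)
  have add: "p (x \<oplus>\<^bsub>N\<^esub> y) = p x \<oplus>\<^bsub>Q\<^esub> p y" if "x \<in> carrier N" "y \<in> carrier N" for x y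
    using hom that by (simp add: left_module_hom_def)
  have UN: "U \<subseteq> carrier N" and WN: "W \<subseteq> carrier N" and VQ: "V \<subseteq> carrier Q"
    using U(1) W'(1) V'(1) by (simp_all add: N.submodule_iff Q.submodule_iff)
  have PW: "\<exists>a\<in>A. \<exists>w\<in>W. x = a \<oplus>\<^bsub>N\<^esub> w" if "x \<in> P" for x
    using that W'(4) by (auto simp: set_add_def')
  have pW: "p ` W = V"
  proof
    show "p ` W \<subseteq> V"
      using W'(2) by (auto simp: P_def)
    \<comment> \<open>Elements of \<open>P\<close> split into a part from \<open>A\<close>, which
      \<open>p\<close> kills, and a part from \<open>W\<close>; so \<open>W\<close> already covers
      \<open>V\<close>.\<close>
    show "V \<subseteq> p ` W"
    proof
      fix v assume v: "v \<in> V"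
      then have "v \<in> p ` carrier N"
        using VQ surj by auto
      with v obtain x where x: "x \<in> P" "v = p x"
        by (auto simp: P_def)
      then obtain a w where aw: "a \<in> A" "w \<in> W" "x = a \<oplus>\<^bsub>N\<^esub> w"
        using PW by blast
      moreover from aw have "a \<in> carrier N" "w \<in> carrier N"
        using U(2) UN WN by auto
      moreover from this have "p w \<in> carrier Q"
        using surj by auto
      ultimately have "v = p w"
        using x(2) add[of a w] ker[of a] by simp
      then show "v \<in> p ` W"
        using aw(2) by blast
    qed
  qed
  have "x \<in> U <+>\<^bsub>N\<^esub> W" if x: "x \<in> carrier N" for x
  proof -
    have "p x \<in> p ` U <+>\<^bsub>Q\<^esub> V"
      using x surj V'(2) by auto
    then obtain u w where uw: "u \<in> U" "w \<in> W" "p x = p u \<oplus>\<^bsub>Q\<^esub> p w"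
      unfolding pW[symmetric] by (auto simp: set_add_def')
    have c: "u \<in> carrier N" "w \<in> carrier N"
      using uw UN WN by auto
    then have "p (u \<oplus>\<^bsub>N\<^esub> w) \<in> carrier Q"
      using surj by auto
    \<comment> \<open>\<open>x\<close> and the sum of \<open>u\<close> and \<open>w\<close> have the
      same image, so their difference lies in \<open>A\<close> and can be absorbed into the summand
      from \<open>U\<close>.\<close>
    then have "p (x \<ominus>\<^bsub>N\<^esub> (u \<oplus>\<^bsub>N\<^esub> w)) = \<zero>\<^bsub>Q\<^esub>"
      using left_module_hom_minus[OF N Q hom x, of "u \<oplus>\<^bsub>N\<^esub> w"] c uw(3) add[OF c]
      by (simp add: Q.minus_eq_zero_iff)
    then have "x \<ominus>\<^bsub>N\<^esub> (u \<oplus>\<^bsub>N\<^esub> w) \<in> U"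
      using ker x c U(2) by auto
    then have "(x \<ominus>\<^bsub>N\<^esub> (u \<oplus>\<^bsub>N\<^esub> w)) \<oplus>\<^bsub>N\<^esub> u \<in> U"
      using U(1) uw(1) by (simp add: N.submodule_iff)
    moreover have "x = ((x \<ominus>\<^bsub>N\<^esub> (u \<oplus>\<^bsub>N\<^esub> w)) \<oplus>\<^bsub>N\<^esub> u) \<oplus>\<^bsub>N\<^esub> w"
      using x c by (simp add: a_minus_def N.M.a_assoc N.M.l_neg)
    ultimately show ?thesis
      using uw(2) by (auto simp: set_add_def')
  qed
  moreover have "U <+>\<^bsub>N\<^esub> W \<subseteq> carrier N"
    using UN WN by (auto simp: set_add_def')
  \<comment> \<open>\<open>p\<close> restricts to a surjection from \<open>W\<close> onto
    \<open>V\<close> whose kernel, the intersection of \<open>A\<close> and \<open>W\<close>, lies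
    in the radical by \<open>W'(5)\<close>.\<close>
  moreover have "x \<in> Rad R (N\<lparr>carrier := W\<rparr>)" if x: "x \<in> U" "x \<in> W" for x
  proof (rule Rad_hom_vimage)
    show "left_module R (N\<lparr>carrier := W\<rparr>)" "left_module R (Q\<lparr>carrier := V\<rparr>)"
      using N.left_module_submodule W'(1) Q.left_module_submodule V'(1) by auto
    show "p \<in> left_module_hom R (N\<lparr>carrier := W\<rparr>) (Q\<lparr>carrier := V\<rparr>)"
      using hom pW WN by (auto simp: left_module_hom_def subset_iff)
    show "p ` carrier (N\<lparr>carrier := W\<rparr>) = carrier (Q\<lparr>carrier := V\<rparr>)"
      using pW by simp
    show "w \<in> Rad R (N\<lparr>carrier := W\<rparr>)"
      if "w \<in> carrier (N\<lparr>carrier := W\<rparr>)" "p w = \<zero>\<^bsub>Q\<lparr>carrier := V\<rparr>\<^esub>" for w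
      using that ker[of w] WN W'(5) by auto
    show "x \<in> carrier (N\<lparr>carrier := W\<rparr>)"
      using x by simp
    show "p x \<in> Rad R (Q\<lparr>carrier := V\<rparr>)"
      using x pW V'(3) by blast
  qed
  ultimately show ?thesis
    using U(1) W'(1) by (auto simp: rad_supplement_def)
qed

section \<open>Rad-supplements of an embedded direct sum\<close>

theorem corollary2p8:
  fixes R :: "('r, 'q) ring_scheme"
    and M\<^sub>1 :: "('r, 'a, 'm) module_scheme"
    and M\<^sub>2 :: "('r, 'b, 'n) module_scheme"
  assumes "ring R"
    and "rad_supplementing TYPE('c) R M\<^sub>1"
    and "rad_supplementing TYPE('c) R M\<^sub>2"
  shows "rad_supplementing TYPE('c) R (direct_sum M\<^sub>1 M\<^sub>2)"
proof -
  have M1: "left_module R M\<^sub>1" and M2: "left_module R M\<^sub>2"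
    using assms(2,3) by (auto simp: rad_supplementing_def)
  interpret M1: left_module R M\<^sub>1 by fact
  interpret M2: left_module R M\<^sub>2 by fact
  have S: "left_module R (direct_sum M\<^sub>1 M\<^sub>2)"
    using left_module_direct_sum[OF M1 M2] .
  interpret S: left_module R "direct_sum M\<^sub>1 M\<^sub>2" by fact
  have "\<exists>W. rad_supplement R N (f ` carrier (direct_sum M\<^sub>1 M\<^sub>2)) W"
    if N: "left_module R N" and f: "f \<in> left_module_hom R (direct_sum M\<^sub>1 M\<^sub>2) N"
      and inj: "inj_on f (carrier (direct_sum M\<^sub>1 M\<^sub>2))"
    for N :: "('r, 'c) module" and f
  proof -
    interpret N: left_module R N by fact
    define U where "U = f ` carrier (direct_sum M\<^sub>1 M\<^sub>2)"
    \<comment> \<open>\<open>f1\<close> and \<open>f2\<close> are the coordinate embeddings into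
      \<open>N\<close>, and \<open>A\<close> is the copy of \<open>M\<^sub>1\<close> there.\<close>
    define f1 where "f1 = (\<lambda>x. f (x, \<zero>\<^bsub>M\<^sub>2\<^esub>))"
    define f2 where "f2 = (\<lambda>y. f (\<zero>\<^bsub>M\<^sub>1\<^esub>, y))"
    define A where "A = f1 ` carrier M\<^sub>1"
    have f_mem: "f (x, y) \<in> carrier N" if "x \<in> carrier M\<^sub>1" "y \<in> carrier M\<^sub>2" for x y
      using f that by (auto simp: left_module_hom_def direct_sum_def)
    have f_add: "f (x \<oplus>\<^bsub>M\<^sub>1\<^esub> x', y \<oplus>\<^bsub>M\<^sub>2\<^esub> y') = f (x, y) \<oplus>\<^bsub>N\<^esub> f (x', y')"
      if "x \<in> carrier M\<^sub>1" "y \<in> carrier M\<^sub>2" "x' \<in> carrier M\<^sub>1" "y' \<in> carrier M\<^sub>2" for x y x' y'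
      using f that by (auto simp: left_module_hom_def direct_sum_def)
    have f_smult: "f (a \<odot>\<^bsub>M\<^sub>1\<^esub> x, a \<odot>\<^bsub>M\<^sub>2\<^esub> y) = a \<odot>\<^bsub>N\<^esub> f (x, y)"
      if "a \<in> carrier R" "x \<in> carrier M\<^sub>1" "y \<in> carrier M\<^sub>2" for a x y
      using f that by (auto simp: left_module_hom_def direct_sum_def)
    have f_inj: "x = x' \<and> y = y'" if "f (x, y) = f (x', y')"
      "x \<in> carrier M\<^sub>1" "y \<in> carrier M\<^sub>2" "x' \<in> carrier M\<^sub>1" "y' \<in> carrier M\<^sub>2" for x y x' y'
      using inj_onD[OF inj that(1)] that by (auto simp: direct_sum_def)
    \<comment> \<open>\<open>f1\<close> and \<open>f2\<close> pad with a zero, which has to survive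
      scalar multiplication before \<open>f_smult\<close> applies.\<close>
    have smult_zero1: "a \<odot>\<^bsub>M\<^sub>1\<^esub> \<zero>\<^bsub>M\<^sub>1\<^esub> = \<zero>\<^bsub>M\<^sub>1\<^esub>" and smult_zero2: "a \<odot>\<^bsub>M\<^sub>2\<^esub> \<zero>\<^bsub>M\<^sub>2\<^esub> = \<zero>\<^bsub>M\<^sub>2\<^esub>"
      if "a \<in> carrier R" for a
      using that M1.smult_r_null M2.smult_r_null by auto
    have f1: "f1 \<in> left_module_hom R M\<^sub>1 N"
      using f_mem f_add[of _ "\<zero>\<^bsub>M\<^sub>2\<^esub>" _ "\<zero>\<^bsub>M\<^sub>2\<^esub>"] f_smult[of _ _ "\<zero>\<^bsub>M\<^sub>2\<^esub>"]
      by (auto simp: f1_def left_module_hom_def smult_zero2)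
    have f2: "f2 \<in> left_module_hom R M\<^sub>2 N"
      using f_mem f_add[of "\<zero>\<^bsub>M\<^sub>1\<^esub>" _ "\<zero>\<^bsub>M\<^sub>1\<^esub>" _] f_smult[of _ "\<zero>\<^bsub>M\<^sub>1\<^esub>" _]
      by (auto simp: f2_def left_module_hom_def smult_zero1)
    have inj1: "inj_on f1 (carrier M\<^sub>1)"
      using f_inj by (auto simp: f1_def inj_on_def)
    have U: "submodule U R N"
      unfolding U_def using submodule_hom_image[OF S N f] S.submodule_iff by auto
    have A: "submodule A R N"
      unfolding A_def using submodule_hom_image[OF M1 N f1] M1.submodule_iff by auto
    have "A \<subseteq> U"
      by (auto simp: A_def U_def f1_def direct_sum_def)
    \<comment> \<open>\<open>Q\<close> is again over the type \<open>'c\<close>, so the hypothesis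
      on \<open>M\<^sub>2\<close> covers it.\<close>
    obtain Q :: "('r, 'c) module" and p where Q: "left_module R Q" "p \<in> left_module_hom R N Q"
      "p ` carrier N = carrier Q" "\<And>x. x \<in> carrier N \<Longrightarrow> p x = \<zero>\<^bsub>Q\<^esub> \<longleftrightarrow> x \<in> A"
      using N.quotient_same_type[OF A] by blast
    interpret Q: left_module R Q by (rule Q(1))
    have p_mem: "p x \<in> carrier Q" if "x \<in> carrier N" for x
      using Q(3) that by auto
    have p2: "p \<circ> f2 \<in> left_module_hom R M\<^sub>2 Q"
      using f2 Q(2) by (auto simp: left_module_hom_def Pi_iff)
    \<comment> \<open>If \<open>y\<close> and \<open>y'\<close> collide, \<open>f2\<close> of their
      difference lies in \<open>A\<close>, the copy of \<open>M\<^sub>1\<close>; injectivity of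
      \<open>f\<close> on pairs forces this difference to be zero.\<close>
    have "inj_on (p \<circ> f2) (carrier M\<^sub>2)"
    proof (rule inj_onI)
      fix y y' assume y: "y \<in> carrier M\<^sub>2" "y' \<in> carrier M\<^sub>2" "(p \<circ> f2) y = (p \<circ> f2) y'"
      have "(p \<circ> f2) (y \<ominus>\<^bsub>M\<^sub>2\<^esub> y') = \<zero>\<^bsub>Q\<^esub>"
        using left_module_hom_minus[OF M2 Q(1) p2 y(1,2)] y p_mem[of "f2 y'"] f_mem
        by (simp add: f2_def Q.minus_eq_zero_iff)
      then have "f2 (y \<ominus>\<^bsub>M\<^sub>2\<^esub> y') \<in> A"
        using Q(4)[of "f2 (y \<ominus>\<^bsub>M\<^sub>2\<^esub> y')"] y f_mem by (simp add: f2_def)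
      then obtain x where "x \<in> carrier M\<^sub>1" "f (\<zero>\<^bsub>M\<^sub>1\<^esub>, y \<ominus>\<^bsub>M\<^sub>2\<^esub> y') = f (x, \<zero>\<^bsub>M\<^sub>2\<^esub>)"
        by (auto simp: A_def f1_def f2_def)
      then have "y \<ominus>\<^bsub>M\<^sub>2\<^esub> y' = \<zero>\<^bsub>M\<^sub>2\<^esub>"
        using f_inj y by simp
      then show "y = y'"
        using y by (simp add: M2.minus_eq_zero_iff)
    qed
    then obtain V where V: "rad_supplement R Q ((p \<circ> f2) ` carrier M\<^sub>2) V"
      using assms(3) Q(1) p2 unfolding rad_supplementing_def by blast
    \<comment> \<open>The first component vanishes in \<open>Q\<close>, so \<open>U\<close> has the
      same image there as the copy of \<open>M\<^sub>2\<close>, and \<open>V\<close> supplements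
      that image.\<close>
    have "p (f (x, y)) = (p \<circ> f2) y" if "x \<in> carrier M\<^sub>1" "y \<in> carrier M\<^sub>2" for x y
    proof -
      have "f (x, y) = f1 x \<oplus>\<^bsub>N\<^esub> f2 y"
        using f_add[of x "\<zero>\<^bsub>M\<^sub>2\<^esub>" "\<zero>\<^bsub>M\<^sub>1\<^esub>" y] that by (simp add: f1_def f2_def)
      moreover have "f1 x \<in> carrier N" "f2 y \<in> carrier N" "p (f1 x) = \<zero>\<^bsub>Q\<^esub>"
        using that Q(4)[of "f1 x"] f_mem by (auto simp: f1_def f2_def A_def)
      ultimately show ?thesis
        using Q(2) p_mem[of "f2 y"] by (simp add: left_module_hom_def)
    qed
    then have "p ` U = (p \<circ> f2) ` snd ` (carrier M\<^sub>1 \<times> carrier M\<^sub>2)"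
      unfolding U_def image_image by (intro image_cong) (auto simp: direct_sum_def)
    \<comment> \<open>The projection is onto because \<open>M\<^sub>1\<close> has a zero to pair
      with.\<close>
    also have "snd ` (carrier M\<^sub>1 \<times> carrier M\<^sub>2) = carrier M\<^sub>2"
      using M1.M.zero_closed by auto
    finally have "p ` U = (p \<circ> f2) ` carrier M\<^sub>2" .
    with V have V': "rad_supplement R Q (p ` U) V"
      by simp
    define P where "P = {x \<in> carrier N. p x \<in> V}"
    have VQ: "submodule V R Q"
      using V by (simp add: rad_supplement_def)
    have P: "left_module R (N\<lparr>carrier := P\<rparr>)"
      unfolding P_def
      using N.left_module_submodule[OF submodule_hom_vimage[OF N Q(1,2) VQ]] .
    \<comment> \<open>\<open>p\<close> sends \<open>A\<close> to zero, which lies in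
      \<open>V\<close>; hence \<open>f1\<close> lands in \<open>P\<close> and the hypothesis on
      \<open>M\<^sub>1\<close> can be used there.\<close>
    have "x \<in> P" if "x \<in> A" for x
      using that Q(4)[of x] A VQ by (auto simp: P_def N.submodule_iff Q.submodule_iff)
    with f1 have "f1 \<in> left_module_hom R M\<^sub>1 (N\<lparr>carrier := P\<rparr>)"
      by (auto simp: A_def left_module_hom_def)
    then obtain W where "rad_supplement R (N\<lparr>carrier := P\<rparr>) A W"
      using assms(2) P inj1 unfolding rad_supplementing_def A_def by blast
    then have "rad_supplement R N U W"
      using rad_supplement_vimage[OF N Q U \<open>A \<subseteq> U\<close> V'] by (simp add: P_def)
    then show ?thesis
      unfolding U_def by blast
  qed
  then show ?thesis
    using S by (simp add: rad_supplementing_def)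
qed

end
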